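(* Let $K$ be a compact Hausdorff space. The product $A\cdot B$ of any two signed intervals $A,B$ in $C(K)$ is a signed interval in $C(K)$.
   Context: $C(K)$ is the Banach algebra of continuous real functions on $K$ with the supremum norm. For $A,B\subset C(K)$, $A\cdot B=\{ab: a\in A,\ b\in B\}$ with pointwise products. An interval in $C(K)$ is a set of the form $[f,g]=\{h\in C(K): f\le h\le g\}$, where $f,g:K\to\mathbb{R}$ are bounded functions (not necessarily continuous) and inequalities between functions are pointwise; an interval may be empty, and such a pair $f,g$ is called a representation of the interval. An interval is signed if it has a representation $[f,g]$ (with $f,g$ bounded) in which either $f>0$ pointwise on $K$ or $g<0$ pointwise on $K$. *)

theory Defs
  imports "HOL-Analysis.Analysis"
begin

(* K is an abstract topology, so the space may be any compact Hausdorff space, including the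
   empty one. Functions on K are HOL functions whose values outside the carrier are fixed by
   extensionality, so that equality of elements of C_of K is equality of functions on K. *)
definition C_of :: "'a topology \<Rightarrow> ('a \<Rightarrow> real) set" where
  "C_of K = {h \<in> extensional (topspace K). continuous_map K euclideanreal h}"

(* For compact K this is the carrier of the library's metric space of bounded continuous
   functions with the supremum metric. *)
lemma C_of_eq_cfunspace:
  assumes "compact_space K"
  shows "C_of K = mspace (cfunspace K euclidean_metric)"
  using assms by (auto simp: C_of_def compact_space_def compactin_mspace_cfunspace simp del: mspace_cfunspace)

definition prod_C :: "'a topology \<Rightarrow> ('a \<Rightarrow> real) set \<Rightarrow> ('a \<Rightarrow> real) set \<Rightarrow> ('a \<Rightarrow> real) set" where
  "prod_C K A B = {restrict (\<lambda>x. a x * b x) (topspace K) | a b. a \<in> A \<and> b \<in> B}"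

definition bounded_fun_on :: "'a topology \<Rightarrow> ('a \<Rightarrow> real) \<Rightarrow> bool" where
  "bounded_fun_on K f \<longleftrightarrow> bounded (f ` topspace K)"

(* The end points are not assumed continuous and f \<le> g is not required, so the interval may
   be empty. *)
definition interval_C :: "'a topology \<Rightarrow> ('a \<Rightarrow> real) \<Rightarrow> ('a \<Rightarrow> real) \<Rightarrow> ('a \<Rightarrow> real) set" where
  "interval_C K f g = {h \<in> C_of K. \<forall>x\<in>topspace K. f x \<le> h x \<and> h x \<le> g x}"

definition signed_interval :: "'a topology \<Rightarrow> ('a \<Rightarrow> real) set \<Rightarrow> bool" where
  "signed_interval K A \<longleftrightarrow>
     (\<exists>f g. bounded_fun_on K f \<and> bounded_fun_on K g \<and> A = interval_C K f g \<and>
        ((\<forall>x\<in>topspace K. f x > 0) \<or> (\<forall>x\<in>topspace K. g x < 0)))"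

end

theory Submission
  imports Defs
begin

text \<open>
  Up to signs both factors consist of positive functions, say \<open>A = [f, g]\<close> and
  \<open>B = [p, q]\<close> with \<open>f, p > 0\<close>. Replacing \<open>f\<close> by the pointwise infimum and \<open>g\<close> by the pointwise
  supremum of \<open>A\<close> does not change the interval, so \<open>f\<close> may be taken upper and \<open>g\<close> lower
  semicontinuous, and likewise for \<open>p\<close> and \<open>q\<close>. Then \<open>A \<cdot> B = [f p, g q]\<close>: given \<open>h\<close> in the
  latter, a factorization \<open>h = a (h / a)\<close> with \<open>a \<in> A\<close> and \<open>h / a \<in> B\<close> amounts to a continuous \<open>a\<close>
  with \<open>max f (h / q) \<le> a \<le> min g (h / p)\<close>. The left bound is upper semicontinuous, the right one
  is lower semicontinuous, and the four inequalities between them hold by the choice of \<open>h\<close>, so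
  the Katetov-Tong insertion theorem yields \<open>a\<close>.
\<close>

section \<open>Insertion of a continuous function\<close>

text \<open>\<open>u x < a x + t\<close> holds exactly when some real \<open>r\<close> lies strictly
  between the two sides, so the set is a union over \<open>r\<close> of intersections of two open
  sets.\<close>

lemma openin_usc_minus_continuous:
  fixes u :: "'a \<Rightarrow> real"
  assumes usc: "\<And>t. openin X {x \<in> topspace X. u x < t}"
    and cont: "continuous_map X euclideanreal a"
  shows "openin X {x \<in> topspace X. u x - a x < t}"
proof -
  have "{x \<in> topspace X. u x - a x < t}
      = (\<Union>r. {x \<in> topspace X. u x < r} \<inter> {x \<in> topspace X. r - t < a x})" (is "?L = ?R")
  proof
    show "?L \<subseteq> ?R"
    proof
      fix x assume x: "x \<in> ?L"
      then have "u x < a x + t" by simp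
      then obtain r where "u x < r" "r < a x + t" using dense by blast
      with x show "x \<in> ?R" by auto
    qed
  qed auto
  moreover have "openin X {x \<in> topspace X. r - t < a x}" for r
    using cont by (simp add: continuous_map_upper_lower_semicontinuous_lt)
  ultimately show ?thesis using usc by (auto intro!: openin_Union)
qed

lemma openin_continuous_minus_lsc:
  fixes l :: "'a \<Rightarrow> real"
  assumes lsc: "\<And>t. openin X {x \<in> topspace X. t < l x}"
    and cont: "continuous_map X euclideanreal a"
  shows "openin X {x \<in> topspace X. t < l x - a x}"
proof -
  have "openin X {x \<in> topspace X. - l x - - a x < - t}"
  proof (rule openin_usc_minus_continuous)
    show "openin X {x \<in> topspace X. - l x < s}" for s
      using lsc[of "- s"] by (simp add: minus_less_iff)
    show "continuous_map X euclideanreal (\<lambda>x. - a x)"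
      using cont by (rule continuous_map_minus)
  qed
  then show ?thesis by (simp add: algebra_simps)
qed

text \<open>One correction step: a Urysohn function with values in \<open>{- d..d}\<close> is added
  to \<open>a\<close>, equal to \<open>- d\<close> where \<open>a\<close> exceeds \<open>l\<close>
  by at least \<open>d\<close> and to \<open>d\<close> where \<open>a\<close> lies at least
  \<open>d\<close> below \<open>u\<close>. These sets are closed by semicontinuity and disjoint
  because \<open>u \<le> l\<close> and \<open>d > 0\<close>. The error drops from
  \<open>3 * d\<close> to \<open>2 * d\<close> at the price of a change of at most \<open>d\<close>,
  which makes the iteration converge geometrically.\<close>

lemma insertion_step:
  fixes u l :: "'a \<Rightarrow> real"
  assumes "normal_space X"
    and usc: "\<And>t. openin X {x \<in> topspace X. u x < t}"
    and lsc: "\<And>t. openin X {x \<in> topspace X. t < l x}"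
    and ul: "\<And>x. x \<in> topspace X \<Longrightarrow> u x \<le> l x"
    and cont: "continuous_map X euclideanreal a"
    and near: "\<And>x. x \<in> topspace X \<Longrightarrow> u x - 3 * d \<le> a x \<and> a x \<le> l x + 3 * d"
    and "d > 0"
  obtains b where "continuous_map X euclideanreal b"
    and "\<And>x. x \<in> topspace X \<Longrightarrow> u x - 2 * d \<le> b x \<and> b x \<le> l x + 2 * d"
    and "\<And>x. x \<in> topspace X \<Longrightarrow> \<bar>b x - a x\<bar> \<le> d"
proof -
  define S where "S = {x \<in> topspace X. l x - a x \<le> - d}"
  define T where "T = {x \<in> topspace X. d \<le> u x - a x}"
  have "S = topspace X - {x \<in> topspace X. - d < l x - a x}"
    "T = topspace X - {x \<in> topspace X. u x - a x < d}"
    by (auto simp: S_def T_def)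
  then have "closedin X S" "closedin X T"
    using openin_usc_minus_continuous[OF usc cont] openin_continuous_minus_lsc[OF lsc cont]
    by auto
  moreover have "disjnt S T"
    using ul \<open>d > 0\<close> by (force simp: S_def T_def disjnt_iff)
  ultimately obtain e where e: "continuous_map X (top_of_set {- d..d}) e"
      "e ` S \<subseteq> {- d}" "e ` T \<subseteq> {d}"
    using Urysohn_lemma[OF \<open>normal_space X\<close>, of S T "- d" d] \<open>d > 0\<close> by auto
  have bound: "- d \<le> e x \<and> e x \<le> d" if "x \<in> topspace X" for x
    using e(1) that by (auto simp: continuous_map_in_subtopology)
  show thesis
  proof
    show "continuous_map X euclideanreal (\<lambda>x. a x + e x)"
      using cont e(1) by (auto simp: continuous_map_in_subtopology intro: continuous_map_add)
    show "\<bar>a x + e x - a x\<bar> \<le> d" if "x \<in> topspace X" for x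
      using bound[OF that] by auto
    show "u x - 2 * d \<le> a x + e x \<and> a x + e x \<le> l x + 2 * d" if x: "x \<in> topspace X" for x
    proof
      \<comment> \<open>On \<open>T\<close> the correction is exactly \<open>d\<close>, which
        improves the old error \<open>3 * d\<close>. Off \<open>T\<close> the function
        \<open>a\<close> is less than \<open>d\<close> below \<open>u\<close>, and a correction of
        at least \<open>- d\<close> costs at most another \<open>d\<close>.\<close>
      show "u x - 2 * d \<le> a x + e x"
      proof (cases "x \<in> T")
        case True
        then have "e x = d" using e(3) by auto
        then show ?thesis using near[OF x] by auto
      next
        case False
        then show ?thesis using bound[OF x] x by (auto simp: T_def)
      qed
      show "a x + e x \<le> l x + 2 * d"
      proof (cases "x \<in> S")
        case True
        then have "e x = - d" using e(2) by auto
        then show ?thesis using near[OF x] by auto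
      next
        case False
        then show ?thesis using bound[OF x] x by (auto simp: S_def)
      qed
    qed
  qed
qed

text \<open>\<open>insertion_step\<close> is iterated with \<open>d = \<epsilon> n / 3\<close>: the
  \<open>n\<close>-th approximation violates the two bounds by at most \<open>\<epsilon> n\<close>,
  and consecutive ones differ by at most \<open>\<epsilon> n / 3\<close>. The series of differences
  converges uniformly, so the limit is continuous and the errors vanish in it.\<close>

theorem Katetov_Tong_insertion:
  fixes u l :: "'a \<Rightarrow> real"
  assumes "normal_space X"
    and usc: "\<And>t. openin X {x \<in> topspace X. u x < t}"
    and lsc: "\<And>t. openin X {x \<in> topspace X. t < l x}"
    and ul: "\<And>x. x \<in> topspace X \<Longrightarrow> u x \<le> l x"
    and bound: "\<And>x. x \<in> topspace X \<Longrightarrow> u x \<le> c \<and> - c \<le> l x"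
  obtains a where "continuous_map X euclideanreal a"
    and "\<And>x. x \<in> topspace X \<Longrightarrow> u x \<le> a x \<and> a x \<le> l x"
proof -
  \<comment> \<open>The zero function starts the iteration, since \<open>u x \<le> C\<close> and
    \<open>- C \<le> l x\<close>. The added 1 makes every \<open>\<epsilon> n\<close> strictly
    positive, as \<open>insertion_step\<close> demands.\<close>
  define C where "C = \<bar>c\<bar> + 1"
  define \<epsilon> where "\<epsilon> n = C * (2/3) ^ n" for n :: nat
  have \<epsilon>_pos: "\<epsilon> n > 0" for n by (simp add: \<epsilon>_def C_def)
  have \<epsilon>_Suc: "\<epsilon> (Suc n) = 2 * (\<epsilon> n / 3)" for n by (simp add: \<epsilon>_def)
  have \<epsilon>_lim: "\<epsilon> \<longlonglongrightarrow> 0"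
    unfolding \<epsilon>_def by (intro tendsto_mult_right_zero LIMSEQ_realpow_zero) auto
  define P where "P n a \<longleftrightarrow> continuous_map X euclideanreal a \<and>
      (\<forall>x \<in> topspace X. u x - \<epsilon> n \<le> a x \<and> a x \<le> l x + \<epsilon> n)" for n a
  define Q where "Q n a b \<longleftrightarrow> (\<forall>x \<in> topspace X. \<bar>b x - a x\<bar> \<le> \<epsilon> n / 3)"
    for n :: nat and a b :: "'a \<Rightarrow> real"
  have "\<exists>s. \<forall>n. P n (s n) \<and> Q n (s n) (s (Suc n))"
  proof (rule dependent_nat_choice)
    have "P 0 (\<lambda>x. 0)"
      using bound by (force simp: P_def \<epsilon>_def C_def)
    then show "\<exists>a. P 0 a" by blast
  next
    fix a n assume "P n a"
    then have "continuous_map X euclideanreal a"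
      and "\<And>x. x \<in> topspace X \<Longrightarrow> u x - 3 * (\<epsilon> n / 3) \<le> a x \<and> a x \<le> l x + 3 * (\<epsilon> n / 3)"
      by (auto simp: P_def)
    from insertion_step[OF \<open>normal_space X\<close> usc lsc ul this] \<epsilon>_pos[of n]
    obtain b where "continuous_map X euclideanreal b"
      and "\<And>x. x \<in> topspace X \<Longrightarrow> u x - \<epsilon> (Suc n) \<le> b x \<and> b x \<le> l x + \<epsilon> (Suc n)"
      and "\<And>x. x \<in> topspace X \<Longrightarrow> \<bar>b x - a x\<bar> \<le> \<epsilon> n / 3"
      unfolding \<epsilon>_Suc by auto
    then show "\<exists>b. P (Suc n) b \<and> Q n a b"
      by (auto simp: P_def Q_def)
  qed
  then obtain s where s: "\<And>n. P n (s n)" "\<And>n. Q n (s n) (s (Suc n))" by blast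
  \<comment> \<open>The limit is written as a telescoping series so that the Weierstrass M-test,
    with the geometric majorant \<open>\<epsilon> n / 3\<close>, gives uniform convergence of
    \<open>s\<close> to it.\<close>
  define a where "a x = s 0 x + (\<Sum>n. s (Suc n) x - s n x)" for x
  have "summable (\<lambda>n. \<epsilon> n / 3)"
    unfolding \<epsilon>_def by (intro summable_divide summable_mult summable_geometric) auto
  with s(2) have "uniform_limit (topspace X) (\<lambda>n x. \<Sum>i<n. s (Suc i) x - s i x)
      (\<lambda>x. \<Sum>n. s (Suc n) x - s n x) sequentially"
    by (intro Weierstrass_m_test[where M = "\<lambda>n. \<epsilon> n / 3"]) (auto simp: Q_def)
  moreover have "(\<Sum>i<n. s (Suc i) x - s i x) = s n x - s 0 x" for n x
    by (rule sum_lessThan_telescope)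
  ultimately have lim: "uniform_limit (topspace X) s a sequentially"
    by (simp add: uniform_limit_iff a_def dist_real_def algebra_simps)
  show thesis
  proof
    have "continuous_map X Met_TC.mtopology a"
    proof (rule Met_TC.continuous_map_uniform_limit_alt)
      show "\<forall>\<^sub>F n in sequentially. continuous_map X Met_TC.mtopology (s n)"
        using s(1) by (simp add: P_def)
      show "\<forall>\<^sub>F n in sequentially. \<forall>x\<in>topspace X. dist (s n x) (a x) < e" if "0 < e" for e
        using lim that by (simp add: uniform_limit_iff)
    qed auto
    then show "continuous_map X euclideanreal a" by simp
  next
    fix x assume x: "x \<in> topspace X"
    have sx: "(\<lambda>n. s n x) \<longlonglongrightarrow> a x" using lim x by (rule tendsto_uniform_limitI)
    have near: "u x - \<epsilon> n \<le> s n x \<and> s n x \<le> l x + \<epsilon> n" for n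
      using s(1) x by (auto simp: P_def)
    have "(\<lambda>n. u x - \<epsilon> n) \<longlonglongrightarrow> u x - 0" "(\<lambda>n. l x + \<epsilon> n) \<longlonglongrightarrow> l x + 0"
      by (intro tendsto_diff tendsto_add tendsto_const \<epsilon>_lim)+
    then show "u x \<le> a x \<and> a x \<le> l x"
      using near sx by (auto intro: LIMSEQ_le)
  qed
qed

section \<open>Intervals with semicontinuous end points\<close>

text \<open>The positive half of \<open>signed_interval\<close>. The other half is obtained from it
  by negation in \<open>signed_interval_iff\<close>, so the product has to be computed for one sign
  only.\<close>

definition positive_interval :: "'a topology \<Rightarrow> ('a \<Rightarrow> real) set \<Rightarrow> bool" where
  "positive_interval K A \<longleftrightarrow>
     (\<exists>f g. bounded_fun_on K f \<and> bounded_fun_on K g \<and> A = interval_C K f g \<and>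
        (\<forall>x\<in>topspace K. f x > 0))"

lemma bounded_fun_on_iff: "bounded_fun_on K f \<longleftrightarrow> (\<exists>c. \<forall>x\<in>topspace K. \<bar>f x\<bar> \<le> c)"
  by (simp add: bounded_fun_on_def bounded_iff)

lemma bounded_fun_on_between:
  assumes "bounded_fun_on K f" "bounded_fun_on K g"
    and "\<And>x. x \<in> topspace K \<Longrightarrow> f x \<le> h x \<and> h x \<le> g x"
  shows "bounded_fun_on K h"
proof -
  obtain c d where "\<forall>x\<in>topspace K. \<bar>f x\<bar> \<le> c" "\<forall>x\<in>topspace K. \<bar>g x\<bar> \<le> d"
    using assms(1,2) unfolding bounded_fun_on_iff by blast
  with assms(3) have "\<forall>x\<in>topspace K. \<bar>h x\<bar> \<le> max c d" by fastforce
  then show ?thesis unfolding bounded_fun_on_iff by blast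
qed

lemma bounded_fun_on_mult:
  assumes "bounded_fun_on K f" "bounded_fun_on K g"
  shows "bounded_fun_on K (\<lambda>x. f x * g x)"
proof -
  obtain c d where "\<forall>x\<in>topspace K. \<bar>f x\<bar> \<le> c" "\<forall>x\<in>topspace K. \<bar>g x\<bar> \<le> d"
    using assms unfolding bounded_fun_on_iff by blast
  then have "\<forall>x\<in>topspace K. \<bar>f x * g x\<bar> \<le> c * d"
    by (metis abs_ge_zero abs_mult mult_mono order_trans)
  then show ?thesis unfolding bounded_fun_on_iff by blast
qed

text \<open>The new end points are the envelopes of \<open>A\<close> itself. For \<open>a\<close> in
  \<open>A\<close> they satisfy \<open>f \<le> F \<le> a \<le> G \<le> g\<close>, so they represent
  the same interval and inherit boundedness and positivity. Nonemptiness makes the infimum and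
  supremum meaningful and gives \<open>F \<le> G\<close>.\<close>

lemma positive_interval_semicontinuous:
  assumes "positive_interval K A" "A \<noteq> {}"
  obtains f g where "bounded_fun_on K f" "bounded_fun_on K g" "A = interval_C K f g"
    and "\<And>x. x \<in> topspace K \<Longrightarrow> 0 < f x" "\<And>x. x \<in> topspace K \<Longrightarrow> f x \<le> g x"
    and "\<And>t. openin K {x \<in> topspace K. f x < t}" "\<And>t. openin K {x \<in> topspace K. t < g x}"
proof -
  obtain f g where fg: "bounded_fun_on K f" "bounded_fun_on K g" "A = interval_C K f g"
    and pos: "\<And>x. x \<in> topspace K \<Longrightarrow> f x > 0"
    using assms(1) unfolding positive_interval_def by blast
  obtain a0 where "a0 \<in> A" using assms(2) by blast
  define F where "F x = (INF a\<in>A. a x)" for x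
  define G where "G x = (SUP a\<in>A. a x)" for x
  have between: "f x \<le> a x \<and> a x \<le> g x" if "a \<in> A" "x \<in> topspace K" for a x
    using that fg(3) by (auto simp: interval_C_def)
  have bdd: "bdd_below ((\<lambda>a. a x) ` A)" "bdd_above ((\<lambda>a. a x) ` A)" if "x \<in> topspace K" for x
    using between that by (auto simp: bdd_below_def bdd_above_def)
  have FG: "F x \<le> a x \<and> a x \<le> G x" if "a \<in> A" "x \<in> topspace K" for a x
    using bdd that by (auto simp: F_def G_def intro: cINF_lower cSUP_upper)
  have fF: "f x \<le> F x" "G x \<le> g x" if "x \<in> topspace K" for x
    using between that assms(2) by (auto simp: F_def G_def intro!: cINF_greatest cSUP_least)
  have FG': "F x \<le> G x" if "x \<in> topspace K" for x
    using FG[OF \<open>a0 \<in> A\<close> that] by simp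
  have cont: "continuous_map K euclideanreal a" if "a \<in> A" for a
    using that fg(3) by (auto simp: interval_C_def C_of_def)
  show thesis
  proof
    show "bounded_fun_on K F" "bounded_fun_on K G"
      using fF FG' by (auto intro!: bounded_fun_on_between[OF fg(1,2)] intro: order_trans)
    show "A = interval_C K F G"
    proof
      show "A \<subseteq> interval_C K F G"
        using FG fg(3) by (auto simp: interval_C_def)
      show "interval_C K F G \<subseteq> A"
        using fF unfolding fg(3) interval_C_def by (auto intro: order_trans)
    qed
    show "0 < F x" "F x \<le> G x" if "x \<in> topspace K" for x
      using pos[OF that] fF[OF that] FG'[OF that] by auto
    show "openin K {x \<in> topspace K. F x < t}" for t
    proof -
      \<comment> \<open>An infimum is below \<open>t\<close> iff some member of the family is, so
        the sublevel set of \<open>F\<close> is a union of open sublevel sets of continuous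
        functions.\<close>
      have "F x < t \<longleftrightarrow> (\<exists>a\<in>A. a x < t)" if "x \<in> topspace K" for x
        unfolding F_def by (rule cINF_less_iff[OF assms(2) bdd(1)[OF that]])
      then have "{x \<in> topspace K. F x < t} = (\<Union>a\<in>A. {x \<in> topspace K. a x < t})"
        by auto
      then show ?thesis
        using cont by (auto simp: continuous_map_upper_lower_semicontinuous_lt intro!: openin_Union)
    qed
    show "openin K {x \<in> topspace K. t < G x}" for t
    proof -
      have "t < G x \<longleftrightarrow> (\<exists>a\<in>A. t < a x)" if "x \<in> topspace K" for x
        unfolding G_def by (rule less_cSUP_iff[OF assms(2) bdd(2)[OF that]])
      then have "{x \<in> topspace K. t < G x} = (\<Union>a\<in>A. {x \<in> topspace K. t < a x})"
        by auto
      then show ?thesis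
        using cont by (auto simp: continuous_map_upper_lower_semicontinuous_lt intro!: openin_Union)
    qed
  qed
qed

section \<open>Products of positive intervals\<close>

text \<open>For \<open>t > 0\<close> the inequality \<open>h x / q x < t\<close> means
  \<open>0 < q x - h x / t\<close>, a lower semicontinuous function minus a continuous one. For
  \<open>t \<le> 0\<close> the set is empty, as the quotient is positive.\<close>

lemma openin_continuous_divide_lsc:
  fixes h q :: "'a \<Rightarrow> real"
  assumes h: "continuous_map X euclideanreal h" "\<And>x. x \<in> topspace X \<Longrightarrow> 0 < h x"
    and q: "\<And>t. openin X {x \<in> topspace X. t < q x}" "\<And>x. x \<in> topspace X \<Longrightarrow> 0 < q x"
  shows "openin X {x \<in> topspace X. h x / q x < t}"
proof (cases "t > 0")
  case True
  then have "{x \<in> topspace X. h x / q x < t} = {x \<in> topspace X. 0 < q x - h x / t}"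
    using q(2) by (auto simp: field_simps)
  moreover have "continuous_map X euclideanreal (\<lambda>x. h x / t)"
    using h(1) True by (intro continuous_intros) auto
  ultimately show ?thesis using openin_continuous_minus_lsc[OF q(1)] by (simp only:)
next
  case False
  have "0 < h x / q x" if "x \<in> topspace X" for x using h(2) q(2) that by simp
  then have "{x \<in> topspace X. h x / q x < t} = {}" using False by force
  then show ?thesis by (simp only: openin_empty)
qed

text \<open>The mirror image of the preceding argument; for \<open>t \<le> 0\<close> the set is now
  the whole space.\<close>

lemma openin_continuous_divide_usc:
  fixes h p :: "'a \<Rightarrow> real"
  assumes h: "continuous_map X euclideanreal h" "\<And>x. x \<in> topspace X \<Longrightarrow> 0 < h x"
    and p: "\<And>t. openin X {x \<in> topspace X. p x < t}" "\<And>x. x \<in> topspace X \<Longrightarrow> 0 < p x"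
  shows "openin X {x \<in> topspace X. t < h x / p x}"
proof (cases "t > 0")
  case True
  then have "{x \<in> topspace X. t < h x / p x} = {x \<in> topspace X. p x - h x / t < 0}"
    using p(2) by (auto simp: field_simps)
  moreover have "continuous_map X euclideanreal (\<lambda>x. h x / t)"
    using h(1) True by (intro continuous_intros) auto
  ultimately show ?thesis using openin_usc_minus_continuous[OF p(1)] by (simp only:)
next
  case False
  have "0 < h x / p x" if "x \<in> topspace X" for x using h(2) p(2) that by simp
  then have "{x \<in> topspace X. t < h x / p x} = topspace X" using False by force
  then show ?thesis by (simp only: openin_topspace)
qed

lemma prod_interval_C:
  assumes "normal_space K" "bounded_fun_on K g"
    and f: "\<And>x. x \<in> topspace K \<Longrightarrow> 0 < f x" "\<And>x. x \<in> topspace K \<Longrightarrow> f x \<le> g x"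
      "\<And>t. openin K {x \<in> topspace K. f x < t}" "\<And>t. openin K {x \<in> topspace K. t < g x}"
    and p: "\<And>x. x \<in> topspace K \<Longrightarrow> 0 < p x" "\<And>x. x \<in> topspace K \<Longrightarrow> p x \<le> q x"
      "\<And>t. openin K {x \<in> topspace K. p x < t}" "\<And>t. openin K {x \<in> topspace K. t < q x}"
  shows "prod_C K (interval_C K f g) (interval_C K p q)
       = interval_C K (\<lambda>x. f x * p x) (\<lambda>x. g x * q x)"
proof
  show "prod_C K (interval_C K f g) (interval_C K p q)
       \<subseteq> interval_C K (\<lambda>x. f x * p x) (\<lambda>x. g x * q x)"
  proof
    fix h assume "h \<in> prod_C K (interval_C K f g) (interval_C K p q)"
    then obtain a b where h: "h = restrict (\<lambda>x. a x * b x) (topspace K)"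
      and a: "a \<in> interval_C K f g" and b: "b \<in> interval_C K p q"
      unfolding prod_C_def by blast
    have "continuous_map K euclideanreal h"
      unfolding h
      by (rule continuous_map_eq[OF continuous_map_real_mult[of K a b]])
        (use a b in \<open>auto simp: interval_C_def C_of_def\<close>)
    moreover have "f x * p x \<le> a x * b x \<and> a x * b x \<le> g x * q x" if x: "x \<in> topspace K" for x
    proof -
      have "f x \<le> a x" "a x \<le> g x" "p x \<le> b x" "b x \<le> q x"
        using a b x by (auto simp: interval_C_def)
      then show ?thesis using f(1)[OF x] p(1)[OF x] by (auto intro!: mult_mono)
    qed
    ultimately show "h \<in> interval_C K (\<lambda>x. f x * p x) (\<lambda>x. g x * q x)"
      by (auto simp: interval_C_def C_of_def h)
  qed
next
  show "interval_C K (\<lambda>x. f x * p x) (\<lambda>x. g x * q x)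
      \<subseteq> prod_C K (interval_C K f g) (interval_C K p q)"
  proof
    fix h assume h: "h \<in> interval_C K (\<lambda>x. f x * p x) (\<lambda>x. g x * q x)"
    then have cont: "continuous_map K euclideanreal h" and ext: "h \<in> extensional (topspace K)"
      and fp: "\<And>x. x \<in> topspace K \<Longrightarrow> f x * p x \<le> h x"
      and gq: "\<And>x. x \<in> topspace K \<Longrightarrow> h x \<le> g x * q x"
      by (auto simp: interval_C_def C_of_def)
    have hpos: "0 < h x" if "x \<in> topspace K" for x
      using fp[OF that] f(1)[OF that] p(1)[OF that] by (meson less_le_trans mult_pos_pos)
    have qpos: "0 < q x" if "x \<in> topspace K" for x
      using p(1,2)[OF that] by simp
    define u where "u x = max (f x) (h x / q x)" for x
    define l where "l x = min (g x) (h x / p x)" for x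
    \<comment> \<open>A maximum is compared with a minimum, so there are four inequalities:
      \<open>f \<le> g\<close> is given, \<open>h / q \<le> h / p\<close> comes from
      \<open>p \<le> q\<close>, and the two mixed ones restate \<open>f p \<le> h\<close> and
      \<open>h \<le> g q\<close>.\<close>
    have ul: "u x \<le> l x" if x: "x \<in> topspace K" for x
    proof -
      have "h x / q x \<le> h x / p x"
        using hpos[OF x] p(1,2)[OF x] by (intro divide_left_mono) auto
      moreover have "f x \<le> h x / p x" "h x / q x \<le> g x"
        using fp[OF x] gq[OF x] p(1)[OF x] qpos[OF x]
        by (simp_all add: pos_le_divide_eq pos_divide_le_eq)
      ultimately show ?thesis
        using f(2)[OF x] by (simp add: u_def l_def)
    qed
    obtain c where c: "\<And>x. x \<in> topspace K \<Longrightarrow> \<bar>g x\<bar> \<le> c"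
      using assms(2) unfolding bounded_fun_on_iff by blast
    obtain a where a: "continuous_map K euclideanreal a"
      and ula: "\<And>x. x \<in> topspace K \<Longrightarrow> u x \<le> a x \<and> a x \<le> l x"
    proof (rule Katetov_Tong_insertion[OF assms(1), of u l c])
      show "openin K {x \<in> topspace K. u x < t}" for t
      proof -
        have "{x \<in> topspace K. u x < t}
            = {x \<in> topspace K. f x < t} \<inter> {x \<in> topspace K. h x / q x < t}"
          by (auto simp: u_def)
        then show ?thesis
          using openin_Int[OF f(3) openin_continuous_divide_lsc[OF cont hpos p(4) qpos]]
          by (simp only:)
      qed
      show "openin K {x \<in> topspace K. t < l x}" for t
      proof -
        have "{x \<in> topspace K. t < l x}
            = {x \<in> topspace K. t < g x} \<inter> {x \<in> topspace K. t < h x / p x}"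
          by (auto simp: l_def)
        then show ?thesis
          using openin_Int[OF f(4) openin_continuous_divide_usc[OF cont hpos p(3,1)]]
          by (simp only:)
      qed
      show "u x \<le> l x" if "x \<in> topspace K" for x using ul[OF that] .
      \<comment> \<open>The chain \<open>0 < f \<le> u \<le> l \<le> g \<le> c\<close> settles both
        bounds.\<close>
      show "u x \<le> c \<and> - c \<le> l x" if x: "x \<in> topspace K" for x
      proof -
        have "f x \<le> u x" "l x \<le> g x" by (auto simp: u_def l_def)
        then show ?thesis using f(1)[OF x] c[OF x] ul[OF x] by auto
      qed
    qed blast
    have apos: "0 < a x" if "x \<in> topspace K" for x
      using f(1)[OF that] ula[OF that] by (auto simp: u_def)
    \<comment> \<open>The inserted function is arbitrary outside the carrier, whereas elements of
      \<open>C_of K\<close> must be extensional; hence the restrictions.\<close>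
    define A where "A = restrict a (topspace K)"
    define B where "B = restrict (\<lambda>x. h x / a x) (topspace K)"
    have "continuous_map K euclideanreal A"
      unfolding A_def by (rule continuous_map_eq[OF a]) auto
    then have "A \<in> interval_C K f g"
      using ula by (auto simp: interval_C_def C_of_def A_def u_def l_def)
    moreover have "continuous_map K euclideanreal B"
      unfolding B_def
      by (rule continuous_map_eq[OF continuous_map_real_divide[OF cont a]])
        (use apos in force)+
    moreover have "p x \<le> h x / a x \<and> h x / a x \<le> q x" if x: "x \<in> topspace K" for x
    proof -
      have "h x / q x \<le> a x" "a x \<le> h x / p x"
        using ula[OF x] by (simp_all add: u_def l_def)
      then show ?thesis
        using apos[OF x] p(1)[OF x] qpos[OF x]
        by (simp add: pos_le_divide_eq pos_divide_le_eq mult.commute)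
    qed
    then have "\<forall>x\<in>topspace K. p x \<le> B x \<and> B x \<le> q x"
      by (simp add: B_def)
    ultimately have AB: "A \<in> interval_C K f g" "B \<in> interval_C K p q"
      by (auto simp: interval_C_def C_of_def B_def)
    have "h = restrict (\<lambda>x. A x * B x) (topspace K)"
    proof
      fix x show "h x = restrict (\<lambda>x. A x * B x) (topspace K) x"
        using ext apos[of x] by (cases "x \<in> topspace K") (auto simp: A_def B_def extensional_def)
    qed
    with AB show "h \<in> prod_C K (interval_C K f g) (interval_C K p q)"
      unfolding prod_C_def by blast
  qed
qed

lemma positive_interval_prod:
  assumes "normal_space K" "positive_interval K A" "positive_interval K B"
  shows "positive_interval K (prod_C K A B)"
proof (cases "A = {} \<or> B = {}")
  case True
  \<comment> \<open>With an empty factor there are no envelopes to take; the product is empty and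
    thus equals that factor, which is a positive interval by assumption.\<close>
  then have "prod_C K A B = {}" by (auto simp: prod_C_def)
  with True assms(2,3) show ?thesis by metis
next
  case False
  then obtain f g where f: "bounded_fun_on K f" "bounded_fun_on K g" "A = interval_C K f g"
    "\<And>x. x \<in> topspace K \<Longrightarrow> 0 < f x" "\<And>x. x \<in> topspace K \<Longrightarrow> f x \<le> g x"
    "\<And>t. openin K {x \<in> topspace K. f x < t}" "\<And>t. openin K {x \<in> topspace K. t < g x}"
    using positive_interval_semicontinuous[OF assms(2)] by blast
  from False obtain p q where p: "bounded_fun_on K p" "bounded_fun_on K q" "B = interval_C K p q"
    "\<And>x. x \<in> topspace K \<Longrightarrow> 0 < p x" "\<And>x. x \<in> topspace K \<Longrightarrow> p x \<le> q x"
    "\<And>t. openin K {x \<in> topspace K. p x < t}" "\<And>t. openin K {x \<in> topspace K. t < q x}"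
    using positive_interval_semicontinuous[OF assms(3)] by blast
  have "prod_C K A B = interval_C K (\<lambda>x. f x * p x) (\<lambda>x. g x * q x)"
    unfolding f(3) p(3) using assms(1) f p by (intro prod_interval_C)
  moreover have "\<forall>x\<in>topspace K. 0 < f x * p x"
    using f(4) p(4) by simp
  ultimately show ?thesis
    unfolding positive_interval_def
    using bounded_fun_on_mult[OF f(1) p(1)] bounded_fun_on_mult[OF f(2) p(2)] by blast
qed

section \<open>Signs\<close>

definition neg_C :: "'a topology \<Rightarrow> ('a \<Rightarrow> real) set \<Rightarrow> ('a \<Rightarrow> real) set" where
  "neg_C K A = (\<lambda>a. restrict (\<lambda>x. - a x) (topspace K)) ` A"

text \<open>Every value of \<open>neg_C\<close> is a set of extensional functions, so negation is an
  involution only on such sets.\<close>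

lemma neg_C_neg_C:
  assumes "A \<subseteq> extensional (topspace K)"
  shows "neg_C K (neg_C K A) = A"
proof -
  have "restrict (\<lambda>x. - restrict (\<lambda>x. - a x) (topspace K) x) (topspace K) = a" if "a \<in> A" for a
    using that assms by (auto simp: fun_eq_iff extensional_def restrict_def)
  then show ?thesis by (simp add: neg_C_def image_image)
qed

lemma interval_C_extensional: "interval_C K f g \<subseteq> extensional (topspace K)"
  by (auto simp: interval_C_def C_of_def)

text \<open>One inclusion is proved for arbitrary end points. The other follows by applying it to
  the negated end points and negating once more, as negation is monotone and involutive.\<close>

lemma neg_C_interval_C: "neg_C K (interval_C K f g) = interval_C K (\<lambda>x. - g x) (\<lambda>x. - f x)"
proof -
  have sub: "neg_C K (interval_C K f g) \<subseteq> interval_C K (\<lambda>x. - g x) (\<lambda>x. - f x)" for f g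
  proof
    fix h assume "h \<in> neg_C K (interval_C K f g)"
    then obtain a where a: "a \<in> interval_C K f g" "h = restrict (\<lambda>x. - a x) (topspace K)"
      by (auto simp: neg_C_def)
    have "continuous_map K euclideanreal h"
      unfolding a(2)
      by (rule continuous_map_eq[OF continuous_map_minus[of K a]])
        (use a(1) in \<open>auto simp: interval_C_def C_of_def\<close>)
    with a show "h \<in> interval_C K (\<lambda>x. - g x) (\<lambda>x. - f x)"
      by (auto simp: interval_C_def C_of_def)
  qed
  have "interval_C K (\<lambda>x. - g x) (\<lambda>x. - f x)
      = neg_C K (neg_C K (interval_C K (\<lambda>x. - g x) (\<lambda>x. - f x)))"
    by (simp add: neg_C_neg_C interval_C_extensional)
  also have "\<dots> \<subseteq> neg_C K (interval_C K f g)"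
    using sub[of "\<lambda>x. - g x" "\<lambda>x. - f x"] by (auto simp: neg_C_def)
  finally show ?thesis using sub by blast
qed

text \<open>If \<open>g < 0\<close>, then \<open>A\<close> is the negation of the interval from
  \<open>- g\<close> to \<open>- f\<close>, whose lower end point is positive.\<close>

lemma signed_interval_iff:
  "signed_interval K A \<longleftrightarrow>
     positive_interval K A \<or> (\<exists>A'. positive_interval K A' \<and> A = neg_C K A')" (is "?L \<longleftrightarrow> ?R")
proof -
  have bounded_minus: "bounded_fun_on K (\<lambda>x. - f x) = bounded_fun_on K f" for f
    by (simp add: bounded_fun_on_iff)
  show ?thesis
  proof
    assume ?L
    then obtain f g where fg: "bounded_fun_on K f" "bounded_fun_on K g" "A = interval_C K f g"
      and "(\<forall>x\<in>topspace K. f x > 0) \<or> (\<forall>x\<in>topspace K. g x < 0)"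
      unfolding signed_interval_def by blast
    then consider "\<forall>x\<in>topspace K. f x > 0" | "\<forall>x\<in>topspace K. g x < 0" by blast
    then show ?R
    proof cases
      case 1
      with fg show ?thesis unfolding positive_interval_def by blast
    next
      case 2
      have "positive_interval K (interval_C K (\<lambda>x. - g x) (\<lambda>x. - f x))"
        unfolding positive_interval_def using fg 2 bounded_minus
        by (intro exI[of _ "\<lambda>x. - g x"] exI[of _ "\<lambda>x. - f x"]) simp
      moreover have "A = neg_C K (interval_C K (\<lambda>x. - g x) (\<lambda>x. - f x))"
        by (simp add: neg_C_interval_C fg(3))
      ultimately show ?thesis by blast
    qed
  next
    assume ?R
    then show ?L
    proof (elim disjE exE conjE)
      assume "positive_interval K A"
      then show ?L unfolding positive_interval_def signed_interval_def by blast
    next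
      fix A' assume "positive_interval K A'" and A: "A = neg_C K A'"
      then obtain f g where "bounded_fun_on K f" "bounded_fun_on K g" "A' = interval_C K f g"
        "\<forall>x\<in>topspace K. f x > 0"
        unfolding positive_interval_def by blast
      then show ?L
        unfolding signed_interval_def A using bounded_minus neg_C_interval_C
        by (intro exI[of _ "\<lambda>x. - g x"] exI[of _ "\<lambda>x. - f x"]) simp
    qed
  qed
qed

text \<open>Writing the product as a union of images reduces the claim to the pointwise identity
  \<open>(- a) b = - (a b)\<close> for restricted functions.\<close>

lemma prod_C_neg_left: "prod_C K (neg_C K A) B = neg_C K (prod_C K A B)"
proof -
  have prod: "prod_C K A B = (\<Union>a\<in>A. (\<lambda>b. restrict (\<lambda>x. a x * b x) (topspace K)) ` B)" for A
    by (auto simp: prod_C_def)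
  have "restrict (\<lambda>x. restrict (\<lambda>x. - a x) (topspace K) x * b x) (topspace K)
      = restrict (\<lambda>x. - restrict (\<lambda>x. a x * b x) (topspace K) x) (topspace K)"
    for a b :: "'a \<Rightarrow> real"
    by auto
  then show ?thesis
    by (simp only: prod neg_C_def image_UN image_image UN_simps)
qed

lemma prod_C_commute: "prod_C K A B = prod_C K B A"
proof -
  have "prod_C K A B \<subseteq> prod_C K B A" for A B
  proof
    fix h assume "h \<in> prod_C K A B"
    then obtain a b where "a \<in> A" "b \<in> B" "h = restrict (\<lambda>x. a x * b x) (topspace K)"
      unfolding prod_C_def by blast
    moreover from this have "h = restrict (\<lambda>x. b x * a x) (topspace K)"
      by (simp add: mult.commute)
    ultimately show "h \<in> prod_C K B A"
      unfolding prod_C_def by blast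
  qed
  then show ?thesis by blast
qed

lemma prod_C_neg_right: "prod_C K A (neg_C K B) = neg_C K (prod_C K A B)"
  by (metis prod_C_commute prod_C_neg_left)

lemma positive_interval_extensional: "positive_interval K A \<Longrightarrow> A \<subseteq> extensional (topspace K)"
  unfolding positive_interval_def using interval_C_extensional by blast

theorem theorem3p2:
  fixes K :: "'a topology" and A B :: "('a \<Rightarrow> real) set"
  assumes "compact_space K" and "Hausdorff_space K"
    and "signed_interval K A" and "signed_interval K B"
  shows "signed_interval K (prod_C K A B)"
proof -
  \<comment> \<open>Compactness and the Hausdorff property enter as normality, which Urysohn's lemma
    requires in the insertion argument.\<close>
  have "normal_space K"
    using assms(1,2) compact_Hausdorff_or_regular_imp_normal_space by blast
  note prod = positive_interval_prod[OF this]
  have signed: "signed_interval K D" "signed_interval K (neg_C K D)"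
    if "positive_interval K D" for D
    using that by (auto simp: signed_interval_iff)
  obtain A' where A': "positive_interval K A'" "A = A' \<or> A = neg_C K A'"
    using assms(3) by (auto simp: signed_interval_iff)
  obtain B' where B': "positive_interval K B'" "B = B' \<or> B = neg_C K B'"
    using assms(4) by (auto simp: signed_interval_iff)
  \<comment> \<open>Needed when both factors are negative: the two signs pulled out of the product
    cancel.\<close>
  have "neg_C K (neg_C K (prod_C K A' B')) = prod_C K A' B'"
    using prod[OF A'(1) B'(1)] by (intro neg_C_neg_C positive_interval_extensional)
  then show ?thesis
    using A'(2) B'(2) signed[OF prod[OF A'(1) B'(1)]]
    by (auto simp: prod_C_neg_left prod_C_neg_right)
qed

end
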